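(* Let $\mathcal{H}$ be a Hilbert space, $\mathcal{C}\subseteq\mathcal{H}$, $\mu,\nu\in(0,\infty)$, and let $V=(V_m)_{m\in\mathbb{N}}$ (with $V_m\subseteq\mathcal{H}$) be a $(\mu,\nu)$-SPOON. If $\bigcup_{m\in\mathbb{N}}V_m\subseteq\mathcal{C}$, then $$\gamma^{\mathrm{Riesz}}(\mathcal{C})\leq \frac{1}{2}+\frac{\mu}{\nu}.$$
   Context: Notation: for $r\in\mathbb{R}_+$, $[r]=\{1,\dots,\lfloor r\rfloor\}$; $\mathcal{P}_+$ is the set of univariate polynomials with non-negative coefficients; $\|\cdot\|$ and $\langle\cdot,\cdot\rangle$ are the norm and inner product of $\mathcal{H}$. SPOON: for $\mu,\nu\in(0,\infty)$, a sequence $V=(V_m)_{m\in\mathbb{N}}$ of sets $V_m\subseteq\mathcal{H}$ is a $(\mu,\nu)$-SPOON if there exist $c,\alpha\in(0,\infty)$ and $m_0\in\mathbb{N}$ such that for every $m\geq m_0$: (i) $|V_m|\geq 2^{m^\alpha}$; (ii) $\|v\|=m^{-\mu}$ for all $v\in V_m$; (iii) $\left|\left\langle \frac{v}{\|v\|},\frac{v'}{\|v'\|}\right\rangle\right|\leq c\,m^{-\nu}$ for all $v,v'\in V_m$ with $v\neq v'$. Approximation rate: an approximation scheme is a sequence $\mathcal{S}=(S_M)_{M\in\mathbb{N}}$ of sets $S_M\subseteq\mathcal{H}$, and for $\mathcal{C}\subseteq\mathcal{H}$, $$\gamma(\mathcal{C},\mathcal{S}):=\sup\Big\{\gamma>0:\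 \Big(M\mapsto\sup_{f\in\mathcal{C}}\inf_{h\in S_M}\|f-h\|\Big)\in\mathcal{O}_{M\to\infty}(M^{-\gamma})\Big\},$$ with $\sup\emptyset=-\infty$. Riesz dictionary: for $T\subseteq\mathbb{N}$ and $c\in(0,\infty)$, a family $\mathcal{D}=(\phi_i)_{i\in T}\subseteq\mathcal{H}$ is a $c$-Riesz dictionary if $\|\phi_i\|=1$ for all $i\in T$ and $\|\sum_{i\in T}a_i\phi_i\|^2\geq c\sum_{i\in T}|a_i|^2$ for every finitely supported sequence $(a_i)_{i\in T}\subseteq\mathbb{R}$. $\mathrm{Riesz}_c(\mathcal{H})$ is the set of all $c$-Riesz dictionaries in $\mathcal{H}$. Superpositional scheme: for a dictionary $\mathcal{D}=(\phi_i)_{i\in T}$ and a polynomial $\pi$, $\mathcal{S}(\mathcal{D},\pi)=(S_M)_{M\in\mathbb{N}}$ with $$S_M:=\Big\{\sum_{i\in I}c_i\phi_i:\ I\subseteq[\pi(M)]\cap T,\ |I|\leq M,\ c\in\mathbb{R}^I,\ \|c\|_\infty\leq\pi(M)\Big\}.$$ Riesz approximation rate: $$\gamma^{\mathrm{Riesz}}(\mathcal{C}):=\sup_{c\in(0,\infty),\ \mathcal{D}\in\mathrm{Riesz}_c(\mathcal{H}),\ \pi\in\mathcal{P}_+}\gamma(\mathcal{C},\mathcal{S}(\mathcal{D},\pi)).$$ *)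

theory Defs
  imports
    "HOL-Analysis.Analysis"
    "HOL-Library.Landau_Symbols"
    "HOL-Computational_Algebra.Polynomial"
begin

text \<open>
  The Hilbert space is a type of sort \<open>{real_inner, complete_space}\<close>; scalars are real.
\<close>

text \<open>
  The disjunct \<open>infinite (V m)\<close> is needed because \<open>card\<close> is \<open>0\<close> on infinite sets.
\<close>

definition spoon :: "real \<Rightarrow> real \<Rightarrow> (nat \<Rightarrow> 'a::real_inner set) \<Rightarrow> bool" where
  "spoon \<mu> \<nu> V \<longleftrightarrow>
     (\<exists>c>0. \<exists>\<alpha>>0. \<exists>m\<^sub>0. \<forall>m\<ge>m\<^sub>0.
        (infinite (V m) \<or> real (card (V m)) \<ge> 2 powr (real m powr \<alpha>)) \<and>
        (\<forall>v\<in>V m. norm v = real m powr (- \<mu>)) \<and>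
        (\<forall>v\<in>V m. \<forall>v'\<in>V m. v \<noteq> v' \<longrightarrow>
           \<bar>inner (v /\<^sub>R norm v) (v' /\<^sub>R norm v')\<bar> \<le> c * real m powr (- \<nu>)))"

text \<open>
  The worst-case error takes values in \<open>[0, \<infinity>]\<close>: it is \<open>\<infinity>\<close> if \<open>C\<close> is not uniformly close to
  \<open>S M\<close>, or if \<open>S M\<close> is empty and \<open>C\<close> is not.
\<close>

definition approx_error :: "'a::real_normed_vector set \<Rightarrow> (nat \<Rightarrow> 'a set) \<Rightarrow> nat \<Rightarrow> ennreal" where
  "approx_error C S M = (SUP f\<in>C. INF h\<in>S M. ennreal (norm (f - h)))"

text \<open>
  Landau symbols are only available for functions into a normed field, so finiteness of the
  error for large \<open>M\<close> is stated separately. The supremum is taken in \<open>ereal\<close>, where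
  \<open>Sup {} = -\<infinity>\<close>.
\<close>

definition approx_rate :: "'a::real_normed_vector set \<Rightarrow> (nat \<Rightarrow> 'a set) \<Rightarrow> ereal" where
  "approx_rate C S =
     Sup {ereal \<gamma> |\<gamma>. \<gamma> > 0 \<and>
            (\<forall>\<^sub>F M in sequentially. approx_error C S M < \<infinity>) \<and>
            (\<lambda>M. enn2real (approx_error C S M)) \<in> O(\<lambda>M. real M powr (- \<gamma>))}"

text \<open>
  A dictionary \<open>(\<phi> i)\<close>, \<open>i \<in> T\<close>, is a pair \<open>(T, \<phi>)\<close>; the values of \<open>\<phi>\<close> and of coefficient
  sequences outside \<open>T\<close> are irrelevant.
\<close>

definition Riesz :: "real \<Rightarrow> (nat set \<times> (nat \<Rightarrow> 'a::real_inner)) set" where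
  "Riesz c =
     {(T, \<phi>). (\<forall>i\<in>T. norm (\<phi> i) = 1) \<and>
        (\<forall>a :: nat \<Rightarrow> real. finite {i\<in>T. a i \<noteq> 0} \<longrightarrow>
           (norm (\<Sum>i | i \<in> T \<and> a i \<noteq> 0. a i *\<^sub>R \<phi> i))\<^sup>2
             \<ge> c * (\<Sum>i | i \<in> T \<and> a i \<noteq> 0. \<bar>a i\<bar>\<^sup>2))}"

definition nonneg_polys :: "real poly set" where
  "nonneg_polys = {p. \<forall>i. coeff p i \<ge> 0}"

definition initial_seg :: "real \<Rightarrow> nat set" where
  "initial_seg r = {1..nat \<lfloor>r\<rfloor>}"

fun superpos_scheme ::
  "nat set \<times> (nat \<Rightarrow> 'a::real_inner) \<Rightarrow> real poly \<Rightarrow> nat \<Rightarrow> 'a set" where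
  "superpos_scheme (T, \<phi>) p M =
     {\<Sum>i\<in>I. c i *\<^sub>R \<phi> i |I c.
        I \<subseteq> initial_seg (poly p (real M)) \<inter> T \<and> card I \<le> M \<and>
        (\<forall>i\<in>I. \<bar>c i\<bar> \<le> poly p (real M))}"

definition riesz_rate :: "'a::real_inner set \<Rightarrow> ereal" where
  "riesz_rate C =
     Sup {approx_rate C (superpos_scheme D p) |c D p.
            c > 0 \<and> D \<in> Riesz c \<and> p \<in> nonneg_polys}"

end

theory Submission
  imports Defs "HOL-Real_Asymp.Real_Asymp"
begin

text \<open>
  Suppose that the rate \<open>\<gamma>\<close> is attained with a \<open>\<kappa>\<close>-Riesz dictionary and a polynomial \<open>p\<close>, and
  that \<open>v \<in> V\<^sub>m\<close> has an approximant \<open>h = (\<Sum>i\<in>I. c\<^sub>i \<phi>\<^sub>i) \<in> S\<^sub>M\<close> with relative error at most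
  \<open>1 / 2\<close>. The Riesz bound and the Cauchy--Schwarz inequality show that the squared correlations
  of \<open>v / \<parallel>v\<parallel>\<close> with the \<open>\<phi>\<^sub>i\<close>, \<open>i \<in> I\<close>, sum to at least \<open>\<kappa> / 9\<close>. Since \<open>I\<close> has at most \<open>M\<close>
  elements, some \<open>\<phi>\<^sub>i\<close> has a squared correlation of at least \<open>t = \<kappa> / (9 M)\<close> with \<open>v / \<parallel>v\<parallel>\<close>
  (\<open>Riesz_correlated_element\<close>). Conversely, if the elements of \<open>V\<^sub>m\<close> are so close to orthogonal
  that \<open>2 c m powr (- \<nu>) \<le> t\<close>, then a Bessel-type inequality allows each \<open>\<phi>\<^sub>i\<close> to be that well correlated
  with at most \<open>2 / t\<close> of them (\<open>card_correlated_le\<close>). Only \<open>p(M)\<close> indices can occur, so \<open>V\<^sub>m\<close>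
  has at most \<open>18 M p(M) / \<kappa>\<close> elements (\<open>card_le_of_superpos_approx\<close>).

  If \<open>\<gamma> > \<mu> / \<nu>\<close>, choose \<open>M \<approx> m powr s\<close> with \<open>\<mu> / \<gamma> < s < \<nu>\<close>. The lower bound on \<open>s\<close> makes the error
  \<open>O(M powr (- \<gamma>))\<close> negligible compared to the norm \<open>m powr (- \<mu>)\<close>, and the upper bound makes
  \<open>m powr (- \<nu>)\<close> negligible compared to \<open>1 / M\<close>. For large \<open>m\<close> the size of \<open>V\<^sub>m\<close> is therefore
  polynomially bounded in \<open>m\<close>, whereas it is at least \<open>2 powr (m powr \<alpha>)\<close>. Hence
  \<open>\<gamma> \<le> \<mu> / \<nu>\<close>, so that the summand \<open>1 / 2\<close> is not even needed (\<open>superpos_rate_le\<close>).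
\<close>

section \<open>Correlation of a vector with the dictionary elements that approximate it\<close>

lemma Riesz_coeff_bound:
  assumes "(T, \<phi>) \<in> Riesz \<kappa>" "finite I" "I \<subseteq> T"
  shows "\<kappa> * (\<Sum>i\<in>I. (c i)\<^sup>2) \<le> (norm (\<Sum>i\<in>I. c i *\<^sub>R \<phi> i))\<^sup>2"
proof -
  define a where "a = (\<lambda>i. if i \<in> I then c i else 0)"
  have supp: "{i\<in>T. a i \<noteq> 0} \<subseteq> I" by (auto simp: a_def)
  have "finite {i\<in>T. a i \<noteq> 0}" using supp assms(2) finite_subset by blast
  then have "\<kappa> * (\<Sum>i | i \<in> T \<and> a i \<noteq> 0. \<bar>a i\<bar>\<^sup>2) \<le> (norm (\<Sum>i | i \<in> T \<and> a i \<noteq> 0. a i *\<^sub>R \<phi> i))\<^sup>2"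
    using assms(1) unfolding Riesz_def by blast
  moreover have "(\<Sum>i | i \<in> T \<and> a i \<noteq> 0. \<bar>a i\<bar>\<^sup>2) = (\<Sum>i\<in>I. (c i)\<^sup>2)"
    by (rule sum.mono_neutral_cong_left) (use assms(2,3) in \<open>auto simp: a_def\<close>)
  moreover have "(\<Sum>i | i \<in> T \<and> a i \<noteq> 0. a i *\<^sub>R \<phi> i) = (\<Sum>i\<in>I. c i *\<^sub>R \<phi> i)"
    by (rule sum.mono_neutral_cong_left) (use assms(2,3) in \<open>auto simp: a_def\<close>)
  ultimately show ?thesis by simp
qed

text \<open>
  Only the lower Riesz bound enters: it controls the \<open>\<ell>\<^sup>2\<close> norm of the coefficients, so the
  correlation of \<open>v\<close> with its approximant forces the correlations of \<open>v\<close> with the \<open>\<phi> i\<close> to be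
  large in \<open>\<ell>\<^sup>2\<close>, and hence one of the at most \<open>M\<close> of them to be large.
\<close>

lemma Riesz_correlated_element:
  fixes v :: "'a::real_inner"
  assumes D: "(T, \<phi>) \<in> Riesz \<kappa>" "\<kappa> > 0" and I: "finite I" "I \<subseteq> T" "card I \<le> M"
    and v: "v \<noteq> 0" "norm (v - (\<Sum>i\<in>I. c i *\<^sub>R \<phi> i)) \<le> norm v / 2"
  shows "\<exists>i\<in>I. \<kappa> / 9 \<le> real M * (inner (v /\<^sub>R norm v) (\<phi> i))\<^sup>2"
proof (rule ccontr)
  assume no: "\<not> ?thesis"
  define h where "h = (\<Sum>i\<in>I. c i *\<^sub>R \<phi> i)"
  define u where "u = v /\<^sub>R norm v"
  define Q where "Q = (\<Sum>i\<in>I. (inner u (\<phi> i))\<^sup>2)"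
  have nv: "norm v > 0" and nu: "norm u = 1" using v(1) by (auto simp: u_def)
  have v_eq: "v = norm v *\<^sub>R u" using nv by (simp add: u_def)
  have "norm h \<le> norm v + norm (v - h)"
    by (metis norm_minus_commute norm_triangle_sub)
  then have nh: "norm h \<le> 3 / 2 * norm v" using v(2) unfolding h_def by simp
  have "inner u v = norm v"
    using nv by (simp add: u_def dot_square_norm power2_eq_square)
  moreover have "inner u (v - h) \<le> norm v / 2"
    using norm_cauchy_schwarz[of u "v - h"] nu v(2) unfolding h_def by simp
  ultimately have uh: "norm v / 2 \<le> inner u h" by (simp add: inner_diff_right)
  have "(inner u h)\<^sup>2 = (\<Sum>i\<in>I. c i * inner u (\<phi> i))\<^sup>2"
    by (simp add: h_def inner_sum_right)
  also have "\<dots> \<le> (\<Sum>i\<in>I. (c i)\<^sup>2) * Q"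
    unfolding Q_def by (rule Cauchy_Schwarz_ineq_sum)
  finally have cs: "(inner u h)\<^sup>2 \<le> (\<Sum>i\<in>I. (c i)\<^sup>2) * Q" .
  have Q0: "Q \<ge> 0" unfolding Q_def by (rule sum_nonneg) simp
  have "\<kappa> * (norm v / 2)\<^sup>2 \<le> \<kappa> * (inner u h)\<^sup>2"
    using uh nv D(2) by (intro mult_left_mono power_mono) auto
  also have "\<dots> \<le> (\<kappa> * (\<Sum>i\<in>I. (c i)\<^sup>2)) * Q"
    using mult_left_mono[OF cs, of \<kappa>] D(2) by (simp add: mult.assoc)
  also have "\<dots> \<le> (norm h)\<^sup>2 * Q"
    unfolding h_def using Riesz_coeff_bound[OF D(1) I(1,2)] Q0 by (intro mult_right_mono) auto
  also have "\<dots> \<le> (3 / 2 * norm v)\<^sup>2 * Q"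
    using nh Q0 by (intro mult_right_mono power_mono) auto
  finally have "(norm v)\<^sup>2 * \<kappa> \<le> (norm v)\<^sup>2 * (9 * Q)"
    by (simp add: power2_eq_square mult_ac)
  then have "\<kappa> \<le> 9 * Q" using nv by simp
  then have Q: "\<kappa> / 9 \<le> Q" by simp
  then have "I \<noteq> {}" using D(2) by (auto simp: Q_def)
  have "real M * Q = (\<Sum>i\<in>I. real M * (inner u (\<phi> i))\<^sup>2)" by (simp add: Q_def sum_distrib_left)
  also have "\<dots> < (\<Sum>i\<in>I. \<kappa> / 9)"
    using no I(1) \<open>I \<noteq> {}\<close> by (intro sum_strict_mono) (auto simp: u_def not_le)
  also have "\<dots> = real (card I) * (\<kappa> / 9)" by simp
  also have "\<dots> \<le> real M * Q" using I(3) Q D(2) by (intro mult_mono) auto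
  finally show False by simp
qed

section \<open>Counting nearly orthogonal vectors\<close>

text \<open>
  A form of Bessel's inequality: a unit vector cannot be well correlated with many nearly
  orthogonal unit vectors. The threshold \<open>t\<close> for the squared correlation must dominate the
  defect \<open>\<epsilon>\<close> from orthogonality.
\<close>

lemma card_correlated_le:
  fixes u :: "'b \<Rightarrow> 'a::real_inner"
  assumes fin: "finite A" and u: "\<And>x. x \<in> A \<Longrightarrow> norm (u x) = 1"
    and orth: "\<And>x y. x \<in> A \<Longrightarrow> y \<in> A \<Longrightarrow> x \<noteq> y \<Longrightarrow> \<bar>inner (u x) (u y)\<bar> \<le> \<epsilon>"
    and w: "norm w = 1" and t: "0 < t" "2 * \<epsilon> \<le> t" "\<epsilon> \<ge> 0"
    and corr: "\<And>x. x \<in> A \<Longrightarrow> t \<le> (inner (u x) w)\<^sup>2"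
  shows "real (card A) * t \<le> 2"
proof (cases "A = {}")
  case False
  define N where "N = real (card A)"
  have N: "N > 0" using False fin by (simp add: N_def card_gt_0_iff)
  \<comment> \<open>The signs make all correlations with \<open>w\<close> add up.\<close>
  define s where "s = (\<lambda>x. sgn (inner (u x) w))"
  define z where "z = (\<Sum>x\<in>A. s x *\<^sub>R u x)"
  have s: "\<bar>s x\<bar> \<le> 1" for x by (simp add: s_def abs_sgn_eq)
  have "N * sqrt t = (\<Sum>x\<in>A. sqrt t)" by (simp add: N_def)
  also have "\<dots> \<le> (\<Sum>x\<in>A. \<bar>inner (u x) w\<bar>)"
    using corr real_sqrt_le_mono by (intro sum_mono) fastforce
  also have "\<dots> = inner z w"
    by (simp add: z_def inner_sum_left s_def abs_sgn mult.commute)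
  also have "\<dots> \<le> norm z" using norm_cauchy_schwarz[of z w] w by simp
  finally have "(N * sqrt t)\<^sup>2 \<le> (norm z)\<^sup>2"
    using N t(1) by (intro power_mono) auto
  also have "(norm z)\<^sup>2 = (\<Sum>x\<in>A. \<Sum>y\<in>A. s x * s y * inner (u x) (u y))"
    unfolding power2_norm_eq_inner z_def
    by (simp add: inner_sum_left inner_sum_right sum_distrib_left inner_commute mult_ac)
  also have "\<dots> \<le> (\<Sum>x\<in>A. \<Sum>y\<in>A. (if x = y then 1 else 0) + \<epsilon>)"
  proof (intro sum_mono)
    fix x y assume xy: "x \<in> A" "y \<in> A"
    have "s x * s y * inner (u x) (u y) \<le> \<bar>s x\<bar> * \<bar>s y\<bar> * \<bar>inner (u x) (u y)\<bar>"
      by (metis abs_ge_self abs_mult)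
    also have "\<dots> \<le> 1 * 1 * \<bar>inner (u x) (u y)\<bar>"
      using s by (intro mult_mono) auto
    also have "\<dots> \<le> (if x = y then 1 else 0) + \<epsilon>"
      using orth[OF xy] u[OF xy(1)] t(3) by (auto simp: dot_square_norm)
    finally show "s x * s y * inner (u x) (u y) \<le> (if x = y then 1 else 0) + \<epsilon>" .
  qed
  also have "\<dots> = N + N * (N * \<epsilon>)"
    by (simp add: sum.distrib N_def fin distrib_left)
  also have "\<dots> \<le> N + N * (N * (t / 2))"
    using N t(2) by (intro add_left_mono mult_left_mono) auto
  finally have "N * (N * t) \<le> N * 2"
    using t(1) by (simp add: power_mult_distrib power2_eq_square algebra_simps)
  then show ?thesis using N by (simp add: N_def)
qed simp

lemma poly_nonneg_polys:
  assumes "p \<in> nonneg_polys" "x \<ge> 0"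
  shows "poly p x \<ge> 0"
  using assms by (auto simp: nonneg_polys_def poly_altdef intro!: sum_nonneg)

lemma poly_nonneg_polys_le:
  assumes "p \<in> nonneg_polys" "1 \<le> x" "x \<le> y"
  shows "poly p x \<le> poly p 1 * y ^ degree p"
proof -
  have "poly p x = (\<Sum>i\<le>degree p. coeff p i * x ^ i)" by (simp add: poly_altdef)
  also have "\<dots> \<le> (\<Sum>i\<le>degree p. coeff p i * y ^ degree p)"
  proof (intro sum_mono mult_left_mono)
    fix i assume "i \<in> {..degree p}"
    then have "x ^ i \<le> x ^ degree p" using assms(2) by (intro power_increasing) auto
    also have "\<dots> \<le> y ^ degree p" using assms(2,3) by (intro power_mono) auto
    finally show "x ^ i \<le> y ^ degree p" .
  qed (use assms(1) in \<open>auto simp: nonneg_polys_def\<close>)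
  finally show ?thesis by (simp add: poly_altdef sum_distrib_right)
qed

text \<open>
  Each vector in the set is well correlated with one of the at most \<open>poly p M\<close> searchable
  dictionary elements, and each of these elements serves few vectors.
\<close>

lemma card_le_of_superpos_approx:
  fixes V :: "'a::real_inner set"
  assumes D: "(T, \<phi>) \<in> Riesz \<kappa>" "\<kappa> > 0" and p: "p \<in> nonneg_polys"
    and M: "18 * real M * \<epsilon> \<le> \<kappa>" "M > 0" "\<epsilon> \<ge> 0"
    and approx: "\<And>v. v \<in> V \<Longrightarrow> v \<noteq> 0 \<and> (\<exists>h\<in>superpos_scheme (T, \<phi>) p M. norm (v - h) \<le> norm v / 2)"
    and orth: "\<And>v v'. v \<in> V \<Longrightarrow> v' \<in> V \<Longrightarrow> v \<noteq> v' \<Longrightarrow>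
                 \<bar>inner (v /\<^sub>R norm v) (v' /\<^sub>R norm v')\<bar> \<le> \<epsilon>"
  shows "finite V" "\<kappa> * real (card V) \<le> 18 * real M * poly p (real M)"
proof -
  \<comment> \<open>the squared correlation that every vector attains with some dictionary element\<close>
  define t where "t = \<kappa> / (9 * real M)"
  have t: "t > 0" "2 * \<epsilon> \<le> t" using D(2) M by (auto simp: t_def field_simps)
  define J where "J = initial_seg (poly p (real M)) \<inter> T"
  have finJ: "finite J" by (simp add: J_def initial_seg_def)
  have "card J \<le> card (initial_seg (poly p (real M)))"
    unfolding J_def by (intro card_mono) (auto simp: initial_seg_def)
  then have cardJ: "real (card J) \<le> poly p (real M)"
    using poly_nonneg_polys[OF p, of "real M"] by (simp add: initial_seg_def) linarith
  define B where "B = (\<lambda>i. {v\<in>V. t \<le> (inner (v /\<^sub>R norm v) (\<phi> i))\<^sup>2})"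
  have cover: "V \<subseteq> (\<Union>i\<in>J. B i)"
  proof
    fix v assume v: "v \<in> V"
    obtain I c where I: "I \<subseteq> J" "card I \<le> M" "norm (v - (\<Sum>i\<in>I. c i *\<^sub>R \<phi> i)) \<le> norm v / 2"
      using approx[OF v] by (auto simp: J_def)
    have "finite I" using I(1) finJ finite_subset by blast
    moreover have "I \<subseteq> T" using I(1) by (auto simp: J_def)
    ultimately obtain i where "i \<in> I" "\<kappa> / 9 \<le> real M * (inner (v /\<^sub>R norm v) (\<phi> i))\<^sup>2"
      using Riesz_correlated_element[OF D, of I M v c] I approx[OF v] by blast
    then show "v \<in> (\<Union>i\<in>J. B i)"
      using I(1) v M(2) by (auto simp: B_def t_def field_simps)
  qed
  have card_sub: "real (card A) * t \<le> 2" if "i \<in> J" "A \<subseteq> B i" "finite A" for i A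
  proof (rule card_correlated_le[where u = "\<lambda>v. v /\<^sub>R norm v" and w = "\<phi> i" and \<epsilon> = \<epsilon>])
    show "norm (\<phi> i) = 1" using D(1) that(1) by (auto simp: Riesz_def J_def)
  qed (use that t M(3) orth approx in \<open>auto simp: B_def subset_iff\<close>)
  have bound: "real (card A) * t \<le> 2 * poly p (real M)" if A: "A \<subseteq> V" "finite A" for A
  proof -
    have "A = (\<Union>i\<in>J. A \<inter> B i)" using cover A(1) by auto
    then have "card A \<le> (\<Sum>i\<in>J. card (A \<inter> B i))" by (metis card_UN_le finJ)
    then have "real (card A) * t \<le> (\<Sum>i\<in>J. real (card (A \<inter> B i))) * t"
      using t(1) by (intro mult_right_mono) (auto simp flip: of_nat_sum)
    also have "\<dots> \<le> (\<Sum>i\<in>J. 2)"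
      unfolding sum_distrib_right using card_sub A(2) by (intro sum_mono) auto
    finally show ?thesis using cardJ by simp
  qed
  \<comment> \<open>The bound holds uniformly over finite subsets, so \<open>V\<close> itself is finite.\<close>
  show fin: "finite V"
  proof (rule ccontr)
    assume "infinite V"
    obtain k where k: "2 * poly p (real M) / t < real k" using reals_Archimedean2 by blast
    obtain A where "A \<subseteq> V" "finite A" "card A = k"
      using infinite_arbitrarily_large[OF \<open>infinite V\<close>] by blast
    then show False using bound[of A] k t(1) by (simp add: field_simps)
  qed
  show "\<kappa> * real (card V) \<le> 18 * real M * poly p (real M)"
    using bound[OF order_refl fin] M(2) by (simp add: t_def field_simps)
qed

section \<open>Approximation rates\<close>

lemma approx_of_error_bound:
  assumes "approx_error C S M < \<infinity>" "enn2real (approx_error C S M) < r" "f \<in> C"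
  shows "\<exists>h\<in>S M. norm (f - h) < r"
proof -
  have "(INF h\<in>S M. ennreal (norm (f - h))) \<le> approx_error C S M"
    unfolding approx_error_def by (rule SUP_upper[OF assms(3)])
  also have "\<dots> = ennreal (enn2real (approx_error C S M))" using assms(1) by simp
  also have "\<dots> < ennreal r" using assms(2) by (simp add: ennreal_less_iff)
  finally show ?thesis by (auto simp: INF_less_iff ennreal_less_iff)
qed

lemma superpos_rate_le:
  fixes V :: "nat \<Rightarrow> 'a::real_inner set"
  assumes pos: "\<mu> > 0" "\<nu> > 0" and V: "spoon \<mu> \<nu> V" "(\<Union>m. V m) \<subseteq> C"
    and D: "(T, \<phi>) \<in> Riesz \<kappa>" "\<kappa> > 0" and p: "p \<in> nonneg_polys"
    and fin: "\<forall>\<^sub>F M in sequentially. approx_error C (superpos_scheme (T, \<phi>) p) M < \<infinity>"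
    and rate: "(\<lambda>M. enn2real (approx_error C (superpos_scheme (T, \<phi>) p) M)) \<in> O(\<lambda>M. real M powr (- \<gamma>))"
  shows "\<gamma> \<le> \<mu> / \<nu>"
proof (rule ccontr)
  assume "\<not> \<gamma> \<le> \<mu> / \<nu>"
  then have less: "\<mu> / \<nu> < \<gamma>" by simp
  have "\<mu> / \<nu> > 0" using pos by simp
  then have \<gamma>: "\<gamma> > 0" using less by linarith
  have "\<mu> / \<gamma> < \<nu>"
    using less pos(2) \<gamma> by (simp add: pos_divide_less_eq mult.commute)
  then obtain s where s0: "\<mu> / \<gamma> < s" "s < \<nu>" using dense by blast
  have "\<mu> / \<gamma> > 0" using pos(1) \<gamma> by simp
  then have "s > 0" using s0(1) by linarith
  then have s: "\<mu> < s * \<gamma>" "s < \<nu>" "s > 0"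
    using s0 \<gamma> by (simp_all add: pos_divide_less_eq)
  obtain c \<alpha> m0 where c: "c > 0" "\<alpha> > 0" and
    sp: "\<And>m. m \<ge> m0 \<Longrightarrow> infinite (V m) \<or> real (card (V m)) \<ge> 2 powr (real m powr \<alpha>)"
      "\<And>m v. m \<ge> m0 \<Longrightarrow> v \<in> V m \<Longrightarrow> norm v = real m powr (- \<mu>)"
      "\<And>m v v'. m \<ge> m0 \<Longrightarrow> v \<in> V m \<Longrightarrow> v' \<in> V m \<Longrightarrow> v \<noteq> v' \<Longrightarrow>
         \<bar>inner (v /\<^sub>R norm v) (v' /\<^sub>R norm v')\<bar> \<le> c * real m powr (- \<nu>)"
    using V(1) unfolding spoon_def by (elim exE conjE) (rule that; blast)
  obtain K where K: "K > 0" "\<forall>\<^sub>F M in sequentially.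
      norm (enn2real (approx_error C (superpos_scheme (T, \<phi>) p) M)) \<le> K * norm (real M powr (- \<gamma>))"
    using landau_o.bigE[OF rate] .
  \<comment> \<open>The infimum need not be attained; doubling the constant leaves room for an approximant.\<close>
  have "\<forall>\<^sub>F M in sequentially. \<forall>f\<in>C. \<exists>h\<in>superpos_scheme (T, \<phi>) p M.
      norm (f - h) < 2 * K * real M powr (- \<gamma>)"
    using K(2) fin eventually_gt_at_top[of 0]
  proof eventually_elim
    case (elim M)
    have "K * real M powr (- \<gamma>) > 0" using K(1) elim(3) by simp
    then have "enn2real (approx_error C (superpos_scheme (T, \<phi>) p) M) < 2 * K * real M powr (- \<gamma>)"
      using elim(1) by simp
    then show ?case using approx_of_error_bound elim(2) by blast
  qed
  then obtain M0 where M0: "\<And>M f. M \<ge> M0 \<Longrightarrow> f \<in> C \<Longrightarrow>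
      \<exists>h\<in>superpos_scheme (T, \<phi>) p M. norm (f - h) < 2 * K * real M powr (- \<gamma>)"
    unfolding eventually_sequentially by blast
  define d where "d = degree p"
  define P where "P = poly p 1"
  define \<sigma> where "\<sigma> = s * \<gamma>"
  define e where "e = (d + 1) * s"
  have "\<mu> < \<sigma>" "e > 0" using s by (simp_all add: \<sigma>_def e_def)
  have "\<forall>\<^sub>F m::nat in sequentially. real m powr s \<ge> real M0"
    using s(3) by real_asymp
  moreover have "\<forall>\<^sub>F m::nat in sequentially. 4 * K * real m powr (- \<sigma>) \<le> real m powr (- \<mu>)"
    using \<open>\<mu> < \<sigma>\<close> K(1) by real_asymp
  moreover have "\<forall>\<^sub>F m::nat in sequentially. 36 * c * real m powr (s - \<nu>) \<le> \<kappa>"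
    using s(2) c(1) D(2) by real_asymp
  moreover have "\<forall>\<^sub>F m::nat in sequentially.
      (36 * P * 2 ^ d) * real m powr e < \<kappa> * 2 powr (real m powr \<alpha>)"
    using c(2) D(2) \<open>e > 0\<close> by real_asymp
  ultimately have "\<forall>\<^sub>F m::nat in sequentially. False"
    using eventually_ge_at_top[of m0] eventually_gt_at_top[of 0]
  proof eventually_elim
    case (elim m)
    define M where "M = nat \<lceil>real m powr s\<rceil>"
    have ms: "real m powr s \<ge> 1" using elim(6) s(3) by (simp add: ge_one_powr_ge_zero)
    have M: "real m powr s \<le> real M" "real M \<le> 2 * real m powr s"
      using ms unfolding M_def by linarith+
    have Mge: "M \<ge> M0" "M > 0" "real M \<ge> 1" using M(1) elim(1) ms by linarith+
    have "real M powr (- \<gamma>) \<le> (real m powr s) powr (- \<gamma>)"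
      using M(1) ms \<gamma> elim(6) by (intro powr_mono2') auto
    then have "2 * K * real M powr (- \<gamma>) \<le> 2 * K * real m powr (- \<sigma>)"
      using K(1) by (simp add: powr_powr \<sigma>_def)
    then have err: "2 * K * real M powr (- \<gamma>) \<le> real m powr (- \<mu>) / 2"
      using elim(2) by linarith
    have approx: "v \<noteq> 0 \<and> (\<exists>h\<in>superpos_scheme (T, \<phi>) p M. norm (v - h) \<le> norm v / 2)"
      if v: "v \<in> V m" for v
    proof -
      have nv: "norm v = real m powr (- \<mu>)" using sp(2)[OF elim(5) v] .
      moreover have "norm v > 0" using nv elim(6) by simp
      moreover obtain h where "h \<in> superpos_scheme (T, \<phi>) p M"
          "norm (v - h) < 2 * K * real M powr (- \<gamma>)"
        using M0[OF Mge(1)] v V(2) by blast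
      moreover have "norm (v - h) \<le> norm v / 2" using calculation err by linarith
      ultimately show ?thesis by (metis zero_less_norm_iff)
    qed
    have "18 * real M * (c * real m powr (- \<nu>)) \<le> 18 * (2 * real m powr s) * (c * real m powr (- \<nu>))"
      using M(2) c(1) by (intro mult_right_mono) auto
    also have "\<dots> = 36 * c * real m powr (s - \<nu>)"
      by (simp add: powr_diff powr_minus_divide)
    finally have eps: "18 * real M * (c * real m powr (- \<nu>)) \<le> \<kappa>" using elim(3) by linarith
    note card = card_le_of_superpos_approx[OF D p eps Mge(2) _ approx sp(3)[OF elim(5)]]
    have "finite (V m)" using card(1) c(1) by simp
    then have "\<kappa> * 2 powr (real m powr \<alpha>) \<le> \<kappa> * real (card (V m))"
      using sp(1)[OF elim(5)] D(2) by simp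
    also have "\<dots> \<le> 18 * real M * poly p (real M)" using card(2) c(1) by simp
    also have "\<dots> \<le> 18 * (2 * real m powr s) * (P * (2 * real m powr s) ^ d)"
      unfolding P_def d_def
      using M Mge(3) poly_nonneg_polys_le[OF p Mge(3) M(2)] poly_nonneg_polys[OF p, of "real M"]
      by (intro mult_mono) auto
    also have "\<dots> = (36 * P * 2 ^ d) * (real m powr s) ^ (d + 1)"
      by (simp add: power_mult_distrib)
    also have "(real m powr s) ^ (d + 1) = real m powr e"
      using elim(6) by (subst powr_power) (simp_all add: e_def)
    finally show False using elim(4) by linarith
  qed
  then show False by simp
qed

theorem theorem3p4:
  fixes C :: "'a::{real_inner, complete_space} set"
    and V :: "nat \<Rightarrow> 'a set"
    and \<mu> \<nu> :: real
  assumes "\<mu> > 0" and "\<nu> > 0"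
    and "spoon \<mu> \<nu> V"
    and "(\<Union>m. V m) \<subseteq> C"
  shows "riesz_rate C \<le> ereal (1 / 2 + \<mu> / \<nu>)"
proof -
  have "approx_rate C (superpos_scheme D p) \<le> ereal (\<mu> / \<nu>)"
    if "c > 0" "D \<in> Riesz c" "p \<in> nonneg_polys" for c p and D :: "nat set \<times> (nat \<Rightarrow> 'a)"
  proof -
    obtain T \<phi> where "D = (T, \<phi>)" by (cases D)
    then show ?thesis
      unfolding approx_rate_def using superpos_rate_le[OF assms] that
      by (intro Sup_least) auto
  qed
  then have "riesz_rate C \<le> ereal (\<mu> / \<nu>)"
    unfolding riesz_rate_def by (intro Sup_least) blast
  also have "\<dots> \<le> ereal (1 / 2 + \<mu> / \<nu>)" by simp
  finally show ?thesis .
qed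

end
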